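(* Let $n\ge 7$, let $r_1,\dots,r_n\ge 2$ be integers, and let $H_n=H_n(r_1,\dots,r_n)=K_{r_1}\square\cdots\square K_{r_n}$ be the Hamming graph of dimension $n$. Let $p(H_n)$ be the maximum cardinality of a minimal hull set of $H_n$ in the $P_3$-convexity. Then: \begin{enumerate} \item If $n\equiv 0 \pmod 3$, then $p(H_n)\le 3\cdot 2^{\frac n3-1}$. \item If $n\equiv 1 \pmod 3$, then $p(H_n)\le 4\cdot 2^{\frac{n-1}3-1}$. \item If $n\equiv 2 \pmod 3$, then $p(H_n)\le 5\cdot 2^{\frac{n-2}3-1}$. \end{enumerate}
   Context: All graphs are finite, simple and undirected. $K_r$ is the complete graph on $\{0,\dots,r-1\}$. The Hamming graph $H_n(r_1,\dots,r_n)=K_{r_1}\square\cdots\square K_{r_n}$ has as vertices the tuples $(x_1,\dots,x_n)$ with $0\le x_i\le r_i-1$; two vertices are adjacent iff they differ in exactly one coordinate. Its dimension is $n$. A set $S\subseteq V(G)$ is $P_3$-convex if every vertex of $V(G)\setminus S$ has at most one neighbor in $S$. The $P_3$-hull $\mathcal H(S)$ of $S\subseteq V(G)$ is the smallest $P_3$-convex set of $G$ containing $S$. A minimal hull set of $G$ is a set $S\subseteq V(G)$ with $\mathcal H(S)=V(G)$ and $\mathcal H(R)\subsetneq V(G)$ for every proper subset $R$ of $S$. $p(G)$ denotes the maximum cardinality of a minimal hull set of $G$. *)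

theory Defs
  imports Complex_Main "HOL-Library.FuncSet" "Graph_Theory.Pair_Digraph"
begin

text \<open>
  A finite simple undirected graph is a \<open>pair_pre_digraph\<close> satisfying the locale
  \<^locale>\<open>pair_graph\<close>: an edge between \<open>u\<close> and \<open>v\<close> is the pair of arcs \<open>(u, v)\<close>, \<open>(v, u)\<close>.
\<close>

definition neighbors :: "'a pair_pre_digraph \<Rightarrow> 'a \<Rightarrow> 'a set" where
  "neighbors G v = {u \<in> pverts G. (v, u) \<in> parcs G}"

definition complete_graph :: "nat \<Rightarrow> nat pair_pre_digraph" where
  "complete_graph r = \<lparr> pverts = {0..<r}, parcs = {(u, v). u < r \<and> v < r \<and> u \<noteq> v} \<rparr>"

text \<open>
  The Cartesian product of the graphs \<open>G i\<close>, \<open>i \<in> I\<close>.  A vertex is a tuple indexed by \<open>I\<close>, i.e. an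
  extensional function on \<open>I\<close>.
\<close>

definition cartesian_product :: "'i set \<Rightarrow> ('i \<Rightarrow> 'a pair_pre_digraph) \<Rightarrow> ('i \<Rightarrow> 'a) pair_pre_digraph"
  where
  "cartesian_product I G = \<lparr>
     pverts = (\<Pi>\<^sub>E i\<in>I. pverts (G i)),
     parcs = {(x, y). x \<in> (\<Pi>\<^sub>E i\<in>I. pverts (G i)) \<and> y \<in> (\<Pi>\<^sub>E i\<in>I. pverts (G i)) \<and>
       (\<exists>i\<in>I. (x i, y i) \<in> parcs (G i) \<and> (\<forall>j\<in>I - {i}. x j = y j))} \<rparr>"

text \<open>Only the values \<open>r 1, \<dots>, r n\<close> matter.\<close>

definition hamming_graph :: "nat \<Rightarrow> (nat \<Rightarrow> nat) \<Rightarrow> (nat \<Rightarrow> nat) pair_pre_digraph" where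
  "hamming_graph n r = cartesian_product {1..n} (\<lambda>i. complete_graph (r i))"

lemma pverts_hamming_graph: "pverts (hamming_graph n r) = (\<Pi>\<^sub>E i\<in>{1..n}. {0..<r i})"
  by (simp add: hamming_graph_def cartesian_product_def complete_graph_def)

lemma parcs_hamming_graph:
  "(x, y) \<in> parcs (hamming_graph n r) \<longleftrightarrow>
     x \<in> pverts (hamming_graph n r) \<and> y \<in> pverts (hamming_graph n r) \<and>
     (\<exists>!i. i \<in> {1..n} \<and> x i \<noteq> y i)"
proof -
  let ?V = "pverts (hamming_graph n r)"
  have "(x i, y i) \<in> parcs (complete_graph (r i)) \<longleftrightarrow> x i \<noteq> y i"
    if "x \<in> ?V" "y \<in> ?V" "i \<in> {1..n}" for i
    using that by (auto simp: pverts_hamming_graph complete_graph_def PiE_iff)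
  then have "(\<exists>i\<in>{1..n}. (x i, y i) \<in> parcs (complete_graph (r i)) \<and> (\<forall>j\<in>{1..n} - {i}. x j = y j))
      \<longleftrightarrow> (\<exists>!i. i \<in> {1..n} \<and> x i \<noteq> y i)" if "x \<in> ?V" "y \<in> ?V"
    using that by (metis DiffD1 DiffD2 DiffI singletonD singletonI)
  moreover have "(x, y) \<in> parcs (hamming_graph n r) \<longleftrightarrow> x \<in> ?V \<and> y \<in> ?V \<and>
      (\<exists>i\<in>{1..n}. (x i, y i) \<in> parcs (complete_graph (r i)) \<and> (\<forall>j\<in>{1..n} - {i}. x j = y j))"
    by (simp add: hamming_graph_def cartesian_product_def)
  ultimately show ?thesis
    by blast
qed

lemma pair_graph_hamming_graph: "pair_graph (hamming_graph n r)"
proof -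
  let ?H = "hamming_graph n r"
  have fin: "finite (pverts ?H)"
    by (simp add: pverts_hamming_graph finite_PiE)
  have sub: "parcs ?H \<subseteq> pverts ?H \<times> pverts ?H"
    using parcs_hamming_graph by auto
  have "symmetric (with_proj ?H)"
    unfolding symmetric_def with_proj_simps
  proof (rule symI)
    fix x y assume "(x, y) \<in> parcs ?H"
    then show "(y, x) \<in> parcs ?H"
      unfolding parcs_hamming_graph neq_commute[of "y _"] by blast
  qed
  moreover have "e \<in> parcs ?H \<Longrightarrow> fst e \<noteq> snd e" for e
    by (cases e) (auto simp: parcs_hamming_graph)
  ultimately show ?thesis
    using fin sub finite_subset[OF sub] by unfold_locales auto
qed

definition p3_convex :: "'a pair_pre_digraph \<Rightarrow> 'a set \<Rightarrow> bool" where
  "p3_convex G S \<longleftrightarrow> S \<subseteq> pverts G \<and> (\<forall>v \<in> pverts G - S. card (neighbors G v \<inter> S) \<le> 1)"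

definition p3_hull :: "'a pair_pre_digraph \<Rightarrow> 'a set \<Rightarrow> 'a set" where
  "p3_hull G S = p3_convex G hull S"

lemma p3_hull_smallest:
  assumes "pair_graph G" and "S \<subseteq> pverts G"
  shows "p3_convex G (p3_hull G S)" and "S \<subseteq> p3_hull G S"
    and "p3_convex G C \<Longrightarrow> S \<subseteq> C \<Longrightarrow> p3_hull G S \<subseteq> C"
proof -
  interpret pair_graph G by fact
  have V: "p3_convex G (pverts G)"
    by (simp add: p3_convex_def)
  have fin: "finite (neighbors G v)" for v
    by (simp add: neighbors_def)
  show "p3_convex G (p3_hull G S)"
    unfolding p3_convex_def
  proof (intro conjI ballI)
    show "p3_hull G S \<subseteq> pverts G"
      unfolding p3_hull_def by (rule hull_minimal) (use assms V in auto)
    fix v assume "v \<in> pverts G - p3_hull G S"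
    then obtain C where C: "p3_convex G C" "S \<subseteq> C" "v \<in> pverts G - C"
      by (auto simp: p3_hull_def hull_def)
    then have "p3_hull G S \<subseteq> C"
      unfolding p3_hull_def by (intro hull_minimal)
    then have "card (neighbors G v \<inter> p3_hull G S) \<le> card (neighbors G v \<inter> C)"
      by (intro card_mono) (use fin in auto)
    also have "\<dots> \<le> 1"
      using C by (auto simp: p3_convex_def)
    finally show "card (neighbors G v \<inter> p3_hull G S) \<le> 1" .
  qed
  show "S \<subseteq> p3_hull G S"
    unfolding p3_hull_def by (rule hull_subset)
  show "p3_convex G C \<Longrightarrow> S \<subseteq> C \<Longrightarrow> p3_hull G S \<subseteq> C"
    unfolding p3_hull_def by (intro hull_minimal)
qed

definition minimal_hull_set :: "'a pair_pre_digraph \<Rightarrow> 'a set \<Rightarrow> bool" where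
  "minimal_hull_set G S \<longleftrightarrow>
     S \<subseteq> pverts G \<and> p3_hull G S = pverts G \<and> (\<forall>R. R \<subset> S \<longrightarrow> p3_hull G R \<subset> pverts G)"

definition max_minimal_hull :: "'a pair_pre_digraph \<Rightarrow> nat" where
  "max_minimal_hull G = Max (card ` {S. minimal_hull_set G S})"

lemma finite_minimal_hull_sets:
  assumes "pair_graph G"
  shows "finite {S. minimal_hull_set G S}"
proof -
  interpret pair_graph G by fact
  show ?thesis
    by (rule finite_subset[of _ "Pow (pverts G)"]) (auto simp: minimal_hull_set_def)
qed

lemma ex_minimal_hull_set:
  assumes "pair_graph G"
  shows "\<exists>S. minimal_hull_set G S"
proof -
  interpret pair_graph G by fact
  let ?F = "{S. S \<subseteq> pverts G \<and> p3_hull G S = pverts G}"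
  have sub: "p3_hull G S \<subseteq> pverts G" if "S \<subseteq> pverts G" for S
    using p3_hull_smallest(1)[OF assms that] by (simp add: p3_convex_def)
  have "finite ?F"
    by simp
  moreover have "pverts G \<in> ?F"
    using sub[of "pverts G"] p3_hull_smallest(2)[OF assms, of "pverts G"] by auto
  ultimately have "\<exists>S\<in>?F. \<forall>R\<in>?F. R \<subseteq> S \<longrightarrow> S = R"
    by (intro finite_has_minimal) auto
  then obtain S where S: "S \<in> ?F" "\<forall>R\<in>?F. R \<subseteq> S \<longrightarrow> S = R" ..
  have "p3_hull G R \<subset> pverts G" if "R \<subset> S" for R
  proof -
    have R: "R \<subseteq> pverts G" "R \<subseteq> S" "S \<noteq> R"
      using that S(1) by auto
    then have "R \<notin> ?F"
      using S(2) by blast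
    then show ?thesis
      using R(1) sub[OF R(1)] by blast
  qed
  then have "minimal_hull_set G S"
    using S(1) by (simp add: minimal_hull_set_def)
  then show ?thesis ..
qed

end

theory Submission
  imports Defs
begin

text \<open>
  The convex sets relevant to a spanning set are subcubes, in which some coordinates are free and all
  others are fixed. Two subcubes at Hamming distance at most 2 have a subcube as the hull of their
  union (\<open>hull_join\<close>), whereas a union of convex sets at pairwise distance at least 3 is again convex
  (\<open>far_convex_Union\<close>). Hence, if the hull of a set \<open>S\<close> of at least two vertices is a subcube, then
  \<open>S\<close> is the union of two proper subsets whose hulls are subcubes (\<open>spanning_set_split\<close>): otherwise
  the maximal proper subsets with this property would have hulls that are far apart, and the hull of
  \<open>S\<close>, being their union, would not be connected.

  Let \<open>p d\<close> be the least number such that every set whose hull is a subcube of dimension at most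
  \<open>d\<close> contains a subset of at most \<open>p d\<close> vertices with the same hull. Take a minimal such subset
  and split it into two proper subsets \<open>A\<close> and \<open>B\<close>; by minimality their hulls have dimension less
  than \<open>d\<close>. If both dimensions are at most \<open>d - 3\<close>, there are at most \<open>2 * p (d - 3)\<close> vertices.
  If one of the hulls has dimension at least \<open>d - 2\<close>, then every vertex of the large cube is within
  distance 2 of it, so single vertices can be added, each raising the dimension, until the large cube
  is reached (\<open>spanning_set_last_step\<close>). Only the last of these vertices has to be paid for, because
  the induction hypothesis applies to all that came before; this gives at most \<open>p (d - 1) + 1\<close>.

  Together with \<open>p 0 = 1\<close>, \<open>p 1 = 2\<close> and \<open>p 2 = 2\<close>, the recurrence
  \<open>p d \<le> max (p (d - 1) + 1) (2 * p (d - 3))\<close> for \<open>d \<ge> 3\<close> yields \<open>p d \<le> d\<close> for \<open>3 \<le> d \<le> 6\<close>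
  and doubles the bound every three dimensions from then on. The value at 2, which is smaller than the
  \<open>p 1 + 1 = 3\<close> of the general step, is needed: a value 3 would give \<open>p 3 \<le> 4\<close> and spoil every later
  bound. It holds because two vertices at distance 2 already span a 2-dimensional cube
  (\<open>small_spanning_subset_2dim\<close>).
\<close>

section \<open>Hulls and subcubes of a Hamming graph\<close>

locale hamming =
  fixes n :: nat and r :: "nat \<Rightarrow> nat"
  assumes two_values: "i \<in> {1..n} \<Longrightarrow> 2 \<le> r i"
begin

abbreviation "V \<equiv> pverts (hamming_graph n r)"
abbreviation "convex \<equiv> p3_convex (hamming_graph n r)"
abbreviation "H \<equiv> p3_hull (hamming_graph n r)"

text \<open>
  The cardinality of this set is the Hamming distance, but joins of cubes need the coordinates
  themselves.
\<close>
definition diff :: "(nat \<Rightarrow> nat) \<Rightarrow> (nat \<Rightarrow> nat) \<Rightarrow> nat set" where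
  "diff x y = {i \<in> {1..n}. x i \<noteq> y i}"

text \<open>
  The set \<open>F\<close> contains the free coordinates, so the dimension of the cube is \<open>card F\<close>.
\<close>
definition cube :: "(nat \<Rightarrow> nat) \<Rightarrow> nat set \<Rightarrow> (nat \<Rightarrow> nat) set" where
  "cube x F = {y \<in> V. diff x y \<subseteq> F}"

lemma finite_V: "finite V"
  by (simp add: pverts_hamming_graph finite_PiE)

lemma finite_diff [simp]: "finite (diff x y)"
  by (simp add: diff_def)

lemma diff_commute: "diff x y = diff y x"
  by (auto simp: diff_def)

lemma diff_self [simp]: "diff x x = {}"
  by (simp add: diff_def)

lemma diff_triangle: "diff x z \<subseteq> diff x y \<union> diff y z"
  by (auto simp: diff_def)

lemma diff_eq_empty:
  assumes "x \<in> V" "y \<in> V" "diff x y = {}"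
  shows "x = y"
proof (rule extensionalityI[of _ "{1..n}"])
  show "x \<in> extensional {1..n}" "y \<in> extensional {1..n}"
    using assms by (auto simp: pverts_hamming_graph PiE_iff)
  show "x i = y i" if "i \<in> {1..n}" for i
    using assms(3) that by (auto simp: diff_def)
qed

lemma diff_subset: "diff x y \<subseteq> {1..n}"
  by (auto simp: diff_def)

lemma update_in_V: "x \<in> V \<Longrightarrow> y \<in> V \<Longrightarrow> i \<in> {1..n} \<Longrightarrow> x(i := y i) \<in> V"
  by (auto simp: pverts_hamming_graph PiE_iff extensional_def)

text \<open>
  This is where the assumption \<open>r i \<ge> 2\<close> enters: a free coordinate really adds vertices, so that the
  dimension of a cube is determined by its vertices.
\<close>
lemma ex_vertex_diff_singleton:
  assumes "x \<in> V" "i \<in> {1..n}"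
  shows "\<exists>y\<in>V. diff x y = {i}"
proof -
  define c where "c = (if x i = 0 then 1 else 0 :: nat)"
  have "c < r i" "c \<noteq> x i"
    using two_values[OF assms(2)] by (auto simp: c_def)
  then have "x(i := c) \<in> V" "diff x (x(i := c)) = {i}"
    using assms by (auto simp: pverts_hamming_graph PiE_iff extensional_def diff_def)
  then show ?thesis by blast
qed

lemma convexD:
  assumes C: "convex C" and uw: "u \<in> C" "w \<in> C" "u \<noteq> w" and v: "v \<in> V"
    and i: "diff v u = {i}" and j: "diff v w = {j}"
  shows "v \<in> C"
proof (rule ccontr)
  assume "v \<notin> C"
  have "C \<subseteq> V"
    using C by (simp add: p3_convex_def)
  have nb: "x \<in> neighbors (hamming_graph n r) v" if "x \<in> C" "diff v x = {k}" for x k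
  proof -
    have "i \<in> {1..n} \<and> v i \<noteq> x i \<longleftrightarrow> i = k" for i
      using that(2) unfolding diff_def set_eq_iff by simp
    then have "\<exists>!i. i \<in> {1..n} \<and> v i \<noteq> x i"
      by (intro ex1I[of _ k]) auto
    then show ?thesis
      using that(1) v \<open>C \<subseteq> V\<close> by (auto simp: neighbors_def parcs_hamming_graph)
  qed
  let ?N = "neighbors (hamming_graph n r) v \<inter> C"
  have "finite ?N"
    using finite_V \<open>C \<subseteq> V\<close> finite_subset by blast
  then have "card {u, w} \<le> card ?N"
    using nb[OF uw(1) i] nb[OF uw(2) j] uw by (intro card_mono) auto
  moreover have "card ?N \<le> 1"
    using C v \<open>v \<notin> C\<close> by (auto simp: p3_convex_def)
  ultimately show False
    using uw(3) by simp
qed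

lemma convexI:
  assumes "C \<subseteq> V"
    and "\<And>u v w i j. u \<in> C \<Longrightarrow> w \<in> C \<Longrightarrow> u \<noteq> w \<Longrightarrow> v \<in> V \<Longrightarrow> diff v u = {i} \<Longrightarrow> diff v w = {j} \<Longrightarrow> v \<in> C"
  shows "convex C"
  unfolding p3_convex_def
proof (intro conjI ballI assms(1))
  fix v assume v: "v \<in> V - C"
  let ?N = "neighbors (hamming_graph n r) v \<inter> C"
  have nb: "\<exists>i. diff v x = {i}" if "x \<in> ?N" for x
  proof -
    have "\<exists>!i. i \<in> {1..n} \<and> v i \<noteq> x i"
      using that by (auto simp: neighbors_def parcs_hamming_graph)
    then show ?thesis
      unfolding diff_def by blast
  qed
  have "u = w" if "u \<in> ?N" "w \<in> ?N" for u w
    using assms(2)[of u w v] nb[OF that(1)] nb[OF that(2)] v that by blast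
  moreover have "finite ?N"
    using finite_V assms(1) finite_subset by blast
  ultimately show "card ?N \<le> 1"
    by (simp add: card_le_Suc0_iff_eq)
qed

lemma hull_smallest:
  assumes "S \<subseteq> V"
  shows "convex (H S)" "S \<subseteq> H S" "convex C \<Longrightarrow> S \<subseteq> C \<Longrightarrow> H S \<subseteq> C"
  using p3_hull_smallest[OF pair_graph_hamming_graph assms] by auto

lemma hull_in_V: "S \<subseteq> V \<Longrightarrow> H S \<subseteq> V"
  using hull_smallest(1) by (simp add: p3_convex_def)

lemma hull_least: "S \<subseteq> V \<Longrightarrow> T \<subseteq> V \<Longrightarrow> S \<subseteq> H T \<Longrightarrow> H S \<subseteq> H T"
  using hull_smallest(1,3) by blast

lemma hull_mono: "S \<subseteq> T \<Longrightarrow> T \<subseteq> V \<Longrightarrow> H S \<subseteq> H T"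
  using hull_least[of S T] hull_smallest(2)[of T] by blast

lemma hull_Un_cong:
  assumes "A \<subseteq> V" "A' \<subseteq> V" "B \<subseteq> V" "B' \<subseteq> V" "H A = H A'" "H B = H B'"
  shows "H (A \<union> B) = H (A' \<union> B')"
proof -
  have "H (A \<union> B) \<subseteq> H (A' \<union> B')"
    if "A \<subseteq> V" "A' \<subseteq> V" "B \<subseteq> V" "B' \<subseteq> V" "H A = H A'" "H B = H B'" for A A' B B'
  proof (rule hull_least)
    have "H A \<subseteq> H (A' \<union> B')" "H B \<subseteq> H (A' \<union> B')"
      using that hull_mono[of A' "A' \<union> B'"] hull_mono[of B' "A' \<union> B'"] by auto
    then show "A \<union> B \<subseteq> H (A' \<union> B')"
      using that hull_smallest(2)[of A] hull_smallest(2)[of B] by blast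
  qed (use that in auto)
  from this[of A A' B B'] this[of A' A B' B] show ?thesis
    using assms by blast
qed

lemma hull_empty: "H {} = {}"
  using hull_smallest(3)[of "{}" "{}"] by (simp add: p3_convex_def)

lemma cube_in_V: "cube x F \<subseteq> V"
  by (auto simp: cube_def)

lemma base_in_cube: "x \<in> V \<Longrightarrow> x \<in> cube x F"
  by (simp add: cube_def)

text \<open>
  A cube may be based at any of its vertices. Cubes to be joined are rebased at a pair of vertices
  that are close to each other.
\<close>
lemma cube_rebase:
  assumes "y \<in> cube x F"
  shows "cube x F = cube y F"
  using assms diff_triangle[of x _ y] diff_triangle[of y _ x] diff_commute[of x y]
  unfolding cube_def by blast

lemma cube_mono: "F \<subseteq> F' \<Longrightarrow> cube x F \<subseteq> cube x F'"
  by (auto simp: cube_def)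

lemma cube_subset_imp_dims_subset:
  assumes "cube y E \<subseteq> cube x F" "y \<in> V" "E \<subseteq> {1..n}"
  shows "E \<subseteq> F"
proof
  fix i assume "i \<in> E"
  then obtain z where z: "z \<in> V" "diff y z = {i}"
    using ex_vertex_diff_singleton assms(2,3) by blast
  then have "z \<in> cube y E"
    using \<open>i \<in> E\<close> by (simp add: cube_def)
  moreover have "y \<in> cube x F"
    using assms(1) base_in_cube[OF assms(2)] by blast
  ultimately have "z \<in> cube y F"
    using assms(1) cube_rebase by blast
  then show "i \<in> F"
    using z by (simp add: cube_def)
qed

lemma cube_convex: "convex (cube x F)"
proof (rule convexI[OF cube_in_V])
  fix u v w i j
  assume u: "u \<in> cube x F" and w: "w \<in> cube x F" and "u \<noteq> w" and v: "v \<in> V"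
    and i: "diff v u = {i}" and j: "diff v w = {j}"
  have sub: "diff x v \<subseteq> F \<union> {i}" "diff x v \<subseteq> F \<union> {j}"
    using u w i j diff_triangle[of x v u] diff_triangle[of x v w] diff_commute[of v u]
      diff_commute[of v w] by (auto simp: cube_def)
  show "v \<in> cube x F"
  proof (cases "i = j \<and> i \<notin> F")
    case True
    have uw: "w \<in> cube u F"
      using cube_rebase[OF u] w by simp
    have "diff u w \<subseteq> {i}"
      using i j True diff_triangle[of u w v] diff_commute[of u v] by auto
    then have "diff u w = {}"
      using uw True by (auto simp: cube_def)
    then show ?thesis
      using diff_eq_empty u w cube_in_V \<open>u \<noteq> w\<close> by blast
  next
    case False
    then show ?thesis
      using sub v by (auto simp: cube_def)
  qed
qed

lemma hull_singleton: "x \<in> V \<Longrightarrow> H {x} = cube x {}"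
proof
  assume x: "x \<in> V"
  show "H {x} \<subseteq> cube x {}"
    using x hull_smallest(3)[OF _ cube_convex] base_in_cube by simp
  have "cube x {} \<subseteq> {x}"
    using x diff_eq_empty by (auto simp: cube_def)
  then show "cube x {} \<subseteq> H {x}"
    using hull_smallest(2)[of "{x}"] x by blast
qed

text \<open>
  The opposite face \<open>cube v F\<close> is filled by induction on the distance from \<open>v\<close>: a vertex of it is
  adjacent to one that is nearer to \<open>v\<close> and to its projection onto \<open>cube a F\<close>. Any other vertex is
  adjacent to its projections onto both faces.
\<close>
lemma convex_grow1:
  assumes C: "convex C" and F: "cube a F \<subseteq> C" and a: "a \<in> V" and v: "v \<in> C"
    and i: "diff a v = {i}"
  shows "cube a (insert i F) \<subseteq> C"
proof (cases "i \<in> F")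
  case True
  then show ?thesis using F by (simp add: insert_absorb)
next
  case False
  have vV: "v \<in> V"
    using C v by (auto simp: p3_convex_def)
  have i': "i \<in> {1..n}" "a i \<noteq> v i"
    using i by (auto simp: diff_def)
  have reset: "w(i := a i) \<in> C" if "w \<in> cube a (insert i F)" for w
  proof -
    have "w(i := a i) \<in> V"
      using that a update_in_V[of w a i] i'(1) by (simp add: cube_def)
    moreover have "diff a (w(i := a i)) \<subseteq> diff a w - {i}"
      by (auto simp: diff_def)
    ultimately have "w(i := a i) \<in> cube a F"
      using that by (auto simp: cube_def)
    then show ?thesis
      using F by blast
  qed
  have face: "w \<in> C" if "w \<in> cube v F" for w
    using that
  proof (induction "card (diff v w)" arbitrary: w rule: less_induct)
    case less
    show ?case
    proof (cases "diff v w = {}")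
      case True
      then show ?thesis
        using diff_eq_empty[OF vV] less.prems v by (auto simp: cube_def)
    next
      case nonempty: False
      then obtain j where j: "j \<in> diff v w" by blast
      have wV: "w \<in> V" and jF: "j \<in> F" and jn: "j \<in> {1..n}" "v j \<noteq> w j"
        using less.prems j by (auto simp: cube_def diff_def)
      define w' where "w' = w(j := v j)"
      have w'V: "w' \<in> V"
        using update_in_V wV vV jn unfolding w'_def by blast
      have dw': "diff v w' = diff v w - {j}"
        by (auto simp: w'_def diff_def)
      have "card (diff v w') < card (diff v w)"
        unfolding dw' using j by (intro card_Diff1_less) auto
      moreover have "w' \<in> cube v F"
        using w'V dw' less.prems by (auto simp: cube_def)
      ultimately have "w' \<in> C"
        using less.hyps by blast
      moreover have wi: "w i = v i"
        using less.prems False i'(1) by (auto simp: cube_def diff_def)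
      have "w \<in> cube a (insert i F)"
        using less.prems diff_triangle[of a w v] i by (auto simp: cube_def)
      then have "w(i := a i) \<in> C"
        by (rule reset)
      moreover have "diff w w' = {j}" "diff w (w(i := a i)) = {i}"
        using jn i' wi by (auto simp: diff_def w'_def)
      moreover have "w' \<noteq> w(i := a i)"
        using \<open>diff w w' = {j}\<close> \<open>diff w (w(i := a i)) = {i}\<close> jF False by auto
      ultimately show ?thesis
        using convexD[OF C] wV by blast
    qed
  qed
  show ?thesis
  proof
    fix w assume w: "w \<in> cube a (insert i F)"
    then have wV: "w \<in> V" by (simp add: cube_def)
    have 1: "w(i := a i) \<in> C"
      using reset w .
    have "w(i := v i) \<in> cube v F"
    proof -
      have "diff v (w(i := v i)) \<subseteq> (diff v a \<union> diff a w) - {i}"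
        by (auto simp: diff_def)
      then show ?thesis
        using w i diff_commute[of v a] update_in_V[OF wV vV i'(1)] by (auto simp: cube_def)
    qed
    then have 2: "w(i := v i) \<in> C"
      by (rule face)
    consider "w i = a i" | "w i = v i" | "w i \<noteq> a i" "w i \<noteq> v i" by blast
    then show "w \<in> C"
    proof cases
      case 3
      then have "diff w (w(i := a i)) = {i}" "diff w (w(i := v i)) = {i}"
        using i' by (auto simp: diff_def)
      moreover have "w(i := a i) \<noteq> w(i := v i)"
        using i'(2) by (metis fun_upd_same)
      ultimately show ?thesis
        using convexD[OF C 1 2] wV by blast
    qed (use 1 2 fun_upd_triv[of w i] in auto)
  qed
qed

text \<open>
  If \<open>a\<close> and \<open>v\<close> are at distance 2, then a common neighbour of them lies in \<open>C\<close>, and the cube grows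
  by one coordinate twice.
\<close>
lemma convex_grow2:
  assumes C: "convex C" and F: "cube a F \<subseteq> C" and a: "a \<in> V" and v: "v \<in> C"
    and D: "card (diff a v) \<le> 2"
  shows "cube a (F \<union> diff a v) \<subseteq> C"
proof -
  have vV: "v \<in> V"
    using C v by (auto simp: p3_convex_def)
  consider "diff a v = {}" | i where "diff a v = {i}" | i j where "i \<noteq> j" "diff a v = {i, j}"
  proof -
    have "card (diff a v) = 0 \<or> card (diff a v) = 1 \<or> card (diff a v) = 2"
      using D by linarith
    then show ?thesis
      using that by (auto simp: card_1_singleton_iff card_2_iff)
  qed
  then show ?thesis
  proof cases
    case 1
    then show ?thesis using F by simp
  next
    case 2
    then show ?thesis using convex_grow1[OF C F a v] by simp
  next
    case (3 i j)
    define u where "u = a(i := v i)"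
    have ij: "i \<in> {1..n}" "j \<in> {1..n}" "a i \<noteq> v i" "a j \<noteq> v j"
      using 3(2) by (auto simp: diff_def)
    have uV: "u \<in> V"
      using update_in_V a vV ij unfolding u_def by blast
    have au: "diff a u = {i}"
      using ij by (auto simp: u_def diff_def)
    have uv: "diff u v = {j}"
      using 3 ij by (auto simp: u_def diff_def)
    have "a \<noteq> v"
      using 3 by auto
    moreover have "a \<in> C"
      using F base_in_cube[OF a] by blast
    ultimately have uC: "u \<in> C"
      using convexD[OF C _ v _ uV _ uv, of a i] au diff_commute[of a u] by simp
    have "u \<in> cube a (insert i F)"
      using uV au by (simp add: cube_def)
    then have eq: "cube a (insert i X) = cube u (insert i X)" for X
      using cube_rebase[of u a "insert i X"] uV au by (auto simp: cube_def)
    have "cube u (insert i F) \<subseteq> C"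
      using convex_grow1[OF C F a uC au] eq by simp
    from convex_grow1[OF C this uV v uv] have "cube u (insert j (insert i F)) \<subseteq> C" .
    moreover have "F \<union> diff a v = insert i (insert j F)"
      using 3 by auto
    ultimately show ?thesis
      using eq[of "insert j F"] by (simp add: insert_commute)
  qed
qed

text \<open>
  Once the cube based at \<open>a\<close> has grown to contain \<open>b\<close>, each coordinate \<open>i\<close> in \<open>E\<close> is added by
  growing towards a vertex of \<open>cube b E\<close> that differs from \<open>b\<close> in \<open>i\<close> only.
\<close>
lemma convex_join_cubes:
  assumes C: "convex C" and F: "cube a F \<subseteq> C" and E: "cube b E \<subseteq> C" and a: "a \<in> V" and b: "b \<in> V"
    and EI: "E \<subseteq> {1..n}" and D: "card (diff a b) \<le> 2"
  shows "cube a (F \<union> E \<union> diff a b) \<subseteq> C"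
proof -
  have "b \<in> C"
    using E base_in_cube[OF b] by blast
  from convex_grow2[OF C F a this D] have 0: "cube a (F \<union> diff a b) \<subseteq> C" .
  have "b \<in> cube a (F \<union> diff a b)"
    using b by (auto simp: cube_def)
  then have rebase: "cube a (F \<union> diff a b \<union> X) = cube b (F \<union> diff a b \<union> X)" for X
    using cube_rebase[of b a "F \<union> diff a b \<union> X"] by (auto simp: cube_def)
  have "finite E"
    using EI finite_subset by blast
  then have "cube b (F \<union> diff a b \<union> E) \<subseteq> C"
    using E EI
  proof (induction E)
    case empty
    then show ?case using 0 rebase[of "{}"] by simp
  next
    case (insert i E)
    have "cube b E \<subseteq> C"
      using insert.prems cube_mono[of E "insert i E" b] by blast
    then have IH: "cube b (F \<union> diff a b \<union> E) \<subseteq> C"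
      using insert by blast
    obtain v where v: "v \<in> V" "diff b v = {i}"
      using ex_vertex_diff_singleton[OF b, of i] insert.prems by blast
    then have "v \<in> C"
      using insert.prems by (auto simp: cube_def)
    from convex_grow1[OF C IH b this v(2)] show ?case by simp
  qed
  then show ?thesis
    using rebase[of E] by (simp add: Un_ac)
qed

lemma hull_join:
  assumes A: "A \<subseteq> V" "H A = cube a F" and B: "B \<subseteq> V" "H B = cube b E"
    and a: "a \<in> V" and b: "b \<in> V" and E: "E \<subseteq> {1..n}" and D: "card (diff a b) \<le> 2"
  shows "H (A \<union> B) = cube a (F \<union> E \<union> diff a b)"
proof
  have "A \<subseteq> cube a F" "B \<subseteq> cube b E"
    using hull_smallest(2)[OF A(1)] hull_smallest(2)[OF B(1)] A B by auto
  moreover have "b \<in> cube a (F \<union> E \<union> diff a b)"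
    using b by (auto simp: cube_def)
  then have "cube b E \<subseteq> cube a (F \<union> E \<union> diff a b)"
    using cube_rebase cube_mono[of E "F \<union> E \<union> diff a b" b] by blast
  moreover have "cube a F \<subseteq> cube a (F \<union> E \<union> diff a b)"
    by (intro cube_mono) auto
  ultimately have "A \<union> B \<subseteq> cube a (F \<union> E \<union> diff a b)"
    by blast
  then show "H (A \<union> B) \<subseteq> cube a (F \<union> E \<union> diff a b)"
    using hull_smallest(3)[OF _ cube_convex] A B by simp
  have "cube a F \<subseteq> H (A \<union> B)" "cube b E \<subseteq> H (A \<union> B)"
    using hull_mono[of A "A \<union> B"] hull_mono[of B "A \<union> B"] A B by auto
  then show "cube a (F \<union> E \<union> diff a b) \<subseteq> H (A \<union> B)"
    using convex_join_cubes[OF hull_smallest(1)] A B a b E D by simp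
qed

section \<open>Splitting a spanning set of a cube\<close>

definition spans_cube :: "(nat \<Rightarrow> nat) set \<Rightarrow> bool" where
  "spans_cube A \<longleftrightarrow> A \<subseteq> V \<and> (\<exists>a\<in>V. \<exists>F\<subseteq>{1..n}. H A = cube a F)"

lemma spans_cubeE:
  assumes "spans_cube A" "x \<in> H A"
  obtains F where "F \<subseteq> {1..n}" "H A = cube x F"
  using assms cube_rebase unfolding spans_cube_def by metis

lemma spans_cube_Un:
  assumes A: "spans_cube A" and B: "spans_cube B" and x: "x \<in> H A" and y: "y \<in> H B"
    and D: "card (diff x y) \<le> 2"
  shows "spans_cube (A \<union> B)"
proof -
  have AV: "A \<subseteq> V" "B \<subseteq> V"
    using A B by (auto simp: spans_cube_def)
  then have xy: "x \<in> V" "y \<in> V"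
    using x y hull_in_V by blast+
  obtain F E where "F \<subseteq> {1..n}" "H A = cube x F" "E \<subseteq> {1..n}" "H B = cube y E"
    using spans_cubeE[OF A x] spans_cubeE[OF B y] by metis
  then have "H (A \<union> B) = cube x (F \<union> E \<union> diff x y)" "F \<union> E \<union> diff x y \<subseteq> {1..n}"
    using hull_join[OF AV(1) _ AV(2)] xy D diff_subset by auto
  then show ?thesis
    using AV xy unfolding spans_cube_def by blast
qed

text \<open>
  A vertex with two neighbours in the union has them in the same member, since two neighbours of one
  vertex are at distance at most 2.
\<close>
lemma far_convex_Union:
  assumes conv: "\<And>A. A \<in> M \<Longrightarrow> convex A"
    and far: "\<And>A B x y. A \<in> M \<Longrightarrow> B \<in> M \<Longrightarrow> A \<noteq> B \<Longrightarrow> x \<in> A \<Longrightarrow> y \<in> B \<Longrightarrow> 2 < card (diff x y)"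
  shows "convex (\<Union>M)"
proof (rule convexI)
  show "\<Union>M \<subseteq> V"
    using conv by (auto simp: p3_convex_def)
  fix u v w i j
  assume u: "u \<in> \<Union>M" and w: "w \<in> \<Union>M" and "u \<noteq> w" "v \<in> V" and i: "diff v u = {i}"
    and j: "diff v w = {j}"
  obtain A B where AB: "A \<in> M" "B \<in> M" "u \<in> A" "w \<in> B"
    using u w by blast
  have "diff u w \<subseteq> {i, j}"
    using diff_triangle[of u w v] diff_commute[of u v] i j by auto
  then have "card (diff u w) \<le> card {i, j}"
    by (intro card_mono) auto
  also have "\<dots> \<le> 2"
    by (simp add: card_insert_if)
  finally have "A = B"
    using far[OF AB(1,2) _ AB(3,4)] by linarith
  then have "v \<in> A"
    using convexD[OF conv[OF AB(1)] AB(3) _ \<open>u \<noteq> w\<close> \<open>v \<in> V\<close> i j] AB(4) by simp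
  then show "v \<in> \<Union>M"
    using AB(1) by blast
qed

text \<open>
  A cube is connected: walking inside it from a vertex of \<open>A\<close> towards a vertex of \<open>B\<close>, the first step
  cannot leave \<open>A\<close>, as the other members are too far away. So the distance between \<open>A\<close> and \<open>B\<close>
  could be decreased for ever.
\<close>
lemma far_Union_not_cube:
  assumes eq: "\<Union>M = cube a F" and AB: "A \<in> M" "B \<in> M" "A \<noteq> B" "A \<noteq> {}" "B \<noteq> {}"
    and far: "\<And>A B x y. A \<in> M \<Longrightarrow> B \<in> M \<Longrightarrow> A \<noteq> B \<Longrightarrow> x \<in> A \<Longrightarrow> y \<in> B \<Longrightarrow> 2 < card (diff x y)"
  shows False
proof -
  have "\<forall>x y. x \<in> A \<longrightarrow> y \<in> B \<longrightarrow> card (diff x y) = d \<longrightarrow> False" for d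
  proof (induction d rule: less_induct)
    case (less d)
    show ?case
    proof (intro allI impI)
      fix x y assume x: "x \<in> A" and y: "y \<in> B" and d: "card (diff x y) = d"
      have "diff x y \<noteq> {}"
        using far[OF AB(1,2,3) x y] by auto
      then obtain i where i: "i \<in> diff x y" by blast
      then have i': "i \<in> {1..n}" "x i \<noteq> y i"
        by (auto simp: diff_def)
      have xy: "x \<in> cube a F" "y \<in> cube a F"
        using x y AB eq by auto
      define x' where "x' = x(i := y i)"
      have "x' \<in> V"
        using update_in_V i'(1) xy cube_in_V unfolding x'_def by blast
      moreover have "diff a x' \<subseteq> F"
        using xy by (auto simp: x'_def cube_def diff_def split: if_splits)
      ultimately have "x' \<in> \<Union>M"
        using eq by (auto simp: cube_def)
      then obtain C where C: "C \<in> M" "x' \<in> C" by blast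
      have "diff x x' = {i}"
        using i' by (auto simp: x'_def diff_def)
      then have "C = A"
        using far[OF AB(1) C(1) _ x C(2)] by auto
      moreover have "diff x' y = diff x y - {i}"
        by (auto simp: x'_def diff_def)
      then have "card (diff x' y) < d"
        using card_Diff1_less[OF _ i] d by simp
      ultimately show False
        using less.IH C(2) y by blast
    qed
  qed
  then show False
    using AB(4,5) by blast
qed

text \<open>
  Two distinct maximal proper subsets with a cube as hull cannot have a proper union with a cube as
  hull. So unless their union is \<open>S\<close>, their hulls are at distance at least 3; if this held for all
  pairs, the hull of \<open>S\<close> would be a disconnected union. The two parts may overlap, which is harmless
  for upper bounds on cardinalities.
\<close>
lemma spanning_set_split:
  assumes S: "spans_cube S" and two: "2 \<le> card S"
  shows "\<exists>A B. A \<subset> S \<and> B \<subset> S \<and> A \<union> B = S \<and> spans_cube A \<and> spans_cube B"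
proof (rule ccontr)
  assume no: "\<not> ?thesis"
  have SV: "S \<subseteq> V" and fin: "finite S"
    using S finite_V finite_subset by (auto simp: spans_cube_def)
  define P where "P = {A. A \<subset> S \<and> spans_cube A}"
  define M where "M = {A \<in> P. \<forall>B\<in>P. A \<subseteq> B \<longrightarrow> A = B}"
  have finP: "finite P"
    using fin by (auto simp: P_def intro: finite_subset[of _ "Pow S"])
  have MP: "A \<in> P" if "A \<in> M" for A
    using that by (simp add: M_def)
  have cover: "\<exists>A\<in>M. s \<in> A" if "s \<in> S" for s
  proof -
    have s: "s \<in> V"
      using that SV by blast
    have "{s} \<noteq> S"
      using two by auto
    then have "{s} \<in> P"
      using that s hull_singleton[OF s] by (auto simp: P_def spans_cube_def)
    then obtain A where "A \<in> P" "{s} \<subseteq> A" "\<forall>B\<in>P. A \<subseteq> B \<longrightarrow> A = B"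
      using finite_has_maximal2[OF finP] by metis
    then show ?thesis
      unfolding M_def by blast
  qed
  have far: "2 < card (diff x y)" if "A \<in> M" "B \<in> M" "A \<noteq> B" "x \<in> H A" "y \<in> H B" for A B x y
  proof (rule ccontr)
    assume "\<not> ?thesis"
    then have "spans_cube (A \<union> B)"
      using spans_cube_Un[of A B x y] that MP by (auto simp: P_def)
    moreover have "A \<subset> S" "B \<subset> S" "spans_cube A" "spans_cube B"
      using MP that by (auto simp: P_def)
    moreover from this have "A \<union> B \<noteq> S"
      using no by blast
    ultimately have "A \<union> B \<in> P"
      unfolding P_def by blast
    moreover have "\<forall>X\<in>P. A \<subseteq> X \<longrightarrow> A = X" "\<forall>X\<in>P. B \<subseteq> X \<longrightarrow> B = X"
      using that(1,2) by (simp_all add: M_def)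
    ultimately have "A = A \<union> B" "B = A \<union> B"
      by (meson Un_upper1 Un_upper2)+
    then show False
      using that(3) by blast
  qed
  have ex: "\<exists>x. x \<in> H A" if "A \<in> M" for A
    using MP[OF that] base_in_cube unfolding P_def spans_cube_def by blast
  have conv: "convex (\<Union>(H ` M))"
  proof (rule far_convex_Union)
    fix A assume "A \<in> H ` M"
    then show "convex A"
      using MP hull_smallest(1) by (auto simp: P_def spans_cube_def)
  next
    fix A B x y assume "A \<in> H ` M" "B \<in> H ` M" "A \<noteq> B" "x \<in> A" "y \<in> B"
    then show "2 < card (diff x y)"
      using far by blast
  qed
  have "S \<subseteq> \<Union>(H ` M)"
  proof
    fix s assume "s \<in> S"
    then obtain A where A: "A \<in> M" "s \<in> A"
      using cover by blast
    then have "A \<subseteq> V"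
      using MP by (auto simp: P_def spans_cube_def)
    then show "s \<in> \<Union>(H ` M)"
      using A hull_smallest(2) by blast
  qed
  then have "H S \<subseteq> \<Union>(H ` M)"
    using hull_smallest(3)[OF SV conv] by blast
  moreover have "H A \<subseteq> H S" if "A \<in> M" for A
    using hull_mono[OF _ SV] MP[OF that] by (auto simp: P_def)
  ultimately have eq: "\<Union>(H ` M) = H S"
    by blast
  obtain s where "s \<in> S"
    using two by fastforce
  then obtain A where A: "A \<in> M"
    using cover by blast
  then obtain t where t: "t \<in> S" "t \<notin> A"
    using MP by (auto simp: P_def)
  then obtain B where B: "B \<in> M" "t \<in> B"
    using cover by blast
  have "H A \<noteq> H B"
  proof
    assume eqAB: "H A = H B"
    obtain x where "x \<in> H A" using ex[OF A] by blast
    then show False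
      using far[OF A B(1), of x x] eqAB t B(2) by auto
  qed
  moreover obtain a F where "\<Union>(H ` M) = cube a F"
    using S eq by (auto simp: spans_cube_def)
  moreover have "2 < card (diff x y)"
    if "A \<in> H ` M" "B \<in> H ` M" "A \<noteq> B" "x \<in> A" "y \<in> B" for A B x y
    using that far by blast
  moreover have "H A \<in> H ` M" "H B \<in> H ` M" "H A \<noteq> {}" "H B \<noteq> {}"
    using A B(1) ex by auto
  ultimately show False
    by (intro far_Union_not_cube[of "H ` M" a F "H A" "H B"])
qed

section \<open>Small spanning subsets\<close>

text \<open>
  The sequence 1, 2, 2, 3, 4, 5, 6, 8, 10, 12, 16, 20, 24, ..., where doubling begins with
  \<open>bound 6 = 2 * bound 3\<close>.
\<close>
fun bound :: "nat \<Rightarrow> nat" where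
  "bound 0 = 1"
| "bound (Suc 0) = 2"
| "bound (Suc (Suc 0)) = 2"
| "bound (Suc (Suc (Suc 0))) = 3"
| "bound (Suc (Suc (Suc (Suc 0)))) = 4"
| "bound (Suc (Suc (Suc (Suc (Suc 0))))) = 5"
| "bound (Suc (Suc (Suc (Suc (Suc (Suc k)))))) = 2 * bound (Suc (Suc (Suc k)))"

lemma bound_ge_1: "1 \<le> bound k"
  by (induction k rule: bound.induct) auto

lemma bound_mono_Suc: "bound k \<le> bound (Suc k)"
  by (induction k rule: bound.induct) auto

lemma bound_mono: "k \<le> m \<Longrightarrow> bound k \<le> bound m"
  by (rule lift_Suc_mono_le[of bound]) (rule bound_mono_Suc)

text \<open>
  The exception \<open>k = 1\<close> is the reason why cubes of dimension 2 get a proof of their own.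
\<close>
lemma bound_Suc: "k \<noteq> 1 \<Longrightarrow> bound k + 1 \<le> bound (Suc k)"
  by (induction k rule: bound.induct) auto

lemma bound_add3: "2 * bound k \<le> bound (k + 3)"
  by (cases k rule: bound.cases) (auto simp: numeral_eq_Suc)

lemma bound_eq:
  assumes "1 \<le> k"
  shows "bound (3 * k) = 3 * 2 ^ (k - 1)" "bound (3 * k + 1) = 4 * 2 ^ (k - 1)"
    "bound (3 * k + 2) = 5 * 2 ^ (k - 1)"
proof -
  have "bound (3 * Suc j) = 3 * 2 ^ j \<and> bound (3 * Suc j + 1) = 4 * 2 ^ j \<and>
    bound (3 * Suc j + 2) = 5 * 2 ^ j" for j
    by (induction j) (auto simp: numeral_eq_Suc)
  from this[of "k - 1"] assms
  show "bound (3 * k) = 3 * 2 ^ (k - 1)" "bound (3 * k + 1) = 4 * 2 ^ (k - 1)"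
    "bound (3 * k + 2) = 5 * 2 ^ (k - 1)" by auto
qed

text \<open>
  The cube is rebased at its vertex nearest to \<open>s\<close>, which differs from \<open>s\<close> exactly in
  \<open>diff a s - E\<close>.
\<close>
lemma hull_insert_outside:
  assumes A: "A \<subseteq> V" "H A = cube a E" and a: "a \<in> V" and s: "s \<in> V" "s \<notin> H A"
    and near: "card (diff a s - E) \<le> 2"
  shows "\<exists>b\<in>V. H (insert s A) = cube b (E \<union> diff a s) \<and> \<not> diff a s \<subseteq> E"
proof (intro bexI conjI)
  define b where "b = (\<lambda>i. if i \<in> E \<and> i \<in> {1..n} then s i else a i)"
  show b: "b \<in> V"
    using a s(1) by (auto simp: b_def pverts_hamming_graph PiE_iff extensional_def)
  have bs: "diff b s = diff a s - E"
    by (auto simp: b_def diff_def)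
  have "b \<in> cube a E"
    using b by (auto simp: cube_def b_def diff_def split: if_splits)
  then have "H A = cube b E"
    using A cube_rebase by simp
  from hull_join[OF A(1) this _ hull_singleton[OF s(1)] b s(1)]
  have "H (A \<union> {s}) = cube b (E \<union> {} \<union> diff b s)"
    using near s bs by simp
  then show "H (insert s A) = cube b (E \<union> diff a s)"
    using bs by simp
  show "\<not> diff a s \<subseteq> E"
    using A(2) s by (simp add: cube_def)
qed

text \<open>
  Every vertex of a cube is within distance 2 of a subcube of codimension at most 2, so any vertex of
  \<open>S\<close> outside the hull of \<open>A\<close> will do.
\<close>
lemma extend_spanning:
  assumes S: "S \<subseteq> V" "H S = cube a F" and F: "F \<subseteq> {1..n}" and A: "A \<subseteq> S"
    and E: "H A = cube b E" "b \<in> V" "E \<subseteq> {1..n}"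
    and ne: "H A \<noteq> H S" and near: "card F \<le> card E + 2"
  shows "\<exists>s\<in>S. \<exists>b'\<in>V. \<exists>E'. E \<subset> E' \<and> E' \<subseteq> F \<and> H (insert s A) = cube b' E'"
proof -
  have finF: "finite F"
    using F finite_subset by blast
  have AV: "A \<subseteq> V"
    using A S by blast
  have sub: "cube b E \<subseteq> cube a F"
    using hull_mono[OF A S(1)] E(1) S(2) by simp
  then have EF: "E \<subseteq> F"
    using cube_subset_imp_dims_subset E by blast
  have "b \<in> cube a F"
    using sub base_in_cube E(2) by blast
  then have SF: "H S = cube b F"
    using cube_rebase S by simp
  have "\<not> S \<subseteq> H A"
    using hull_least[OF S(1) AV] hull_mono[OF A S(1)] ne by blast
  then obtain s where s: "s \<in> S" "s \<notin> H A" by blast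
  have sV: "s \<in> V"
    using s S by blast
  have ds: "diff b s \<subseteq> F"
    using hull_smallest(2)[OF S(1)] s(1) SF by (auto simp: cube_def)
  have "card (diff b s - E) \<le> card (F - E)"
    using ds finF by (intro card_mono) auto
  also have "\<dots> \<le> 2"
    using near card_Diff_subset[OF finite_subset[OF EF finF] EF] by simp
  finally obtain b' where "b' \<in> V" "H (insert s A) = cube b' (E \<union> diff b s)" "\<not> diff b s \<subseteq> E"
    using hull_insert_outside[OF AV E(1,2) sV s(2)] by blast
  moreover from this have "E \<subset> E \<union> diff b s" "E \<union> diff b s \<subseteq> F"
    using EF ds by auto
  ultimately show ?thesis
    using s(1) by blast
qed

text \<open>
  The hull of \<open>A\<close> lacks at most two dimensions, so at most two extensions by a vertex reach the hull
  of \<open>S\<close>; \<open>A'\<close> is what precedes the last one. For counting it is enough that the hull of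
  \<open>A'\<close> is some smaller cube.
\<close>
lemma spanning_set_last_step:
  assumes S: "S \<subseteq> V" "H S = cube a F" and F: "F \<subseteq> {1..n}" and A: "A \<subseteq> S"
    and E: "H A = cube b E" "b \<in> V" "E \<subseteq> {1..n}"
    and ne: "H A \<noteq> H S" and near: "card F \<le> card E + 2"
  shows "\<exists>s\<in>S. \<exists>A'\<subseteq>S. \<exists>b'\<in>V. \<exists>E'. E' \<subset> F \<and> H A' = cube b' E' \<and> H (insert s A') = H S"
proof -
  have finF: "finite F"
    using F finite_subset by blast
  have step: "\<exists>s\<in>S. \<exists>b'\<in>V. \<exists>E'. E \<subset> E' \<and> E' \<subseteq> F \<and> H (insert s A) = cube b' E' \<and>
      (E' = F \<longrightarrow> H (insert s A) = H S)"
    if "A \<subseteq> S" "H A = cube b E" "b \<in> V" "E \<subseteq> {1..n}" "H A \<noteq> H S" "card F \<le> card E + 2" for A b E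
  proof -
    note A = that
    obtain s b' E' where s: "s \<in> S" "b' \<in> V" "E \<subset> E'" "E' \<subseteq> F" "H (insert s A) = cube b' E'"
      using extend_spanning[OF S F A] by blast
    have "H (insert s A) = H S" if "E' = F"
    proof -
      have "H (insert s A) \<subseteq> H S"
        using s(1) \<open>A \<subseteq> S\<close> by (intro hull_mono S) auto
      then have "b' \<in> cube a F"
        using base_in_cube[OF s(2), of E'] s(5) S(2) by auto
      then show ?thesis
        using cube_rebase s(5) S(2) that by simp
    qed
    then show ?thesis
      using s by blast
  qed
  obtain s b' E' where 1: "s \<in> S" "b' \<in> V" "E \<subset> E'" "E' \<subseteq> F" "H (insert s A) = cube b' E'"
      "E' = F \<longrightarrow> H (insert s A) = H S"
    using step[OF A E ne near] by blast
  show ?thesis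
  proof (cases "E' = F")
    case True
    then show ?thesis
      using 1 A E by blast
  next
    case False
    then have E'F: "E' \<subset> F"
      using 1(4) by blast
    have "card E < card E'"
      using 1(3,4) finF finite_subset psubset_card_mono by metis
    then have card': "card F \<le> card E' + 1"
      using near by simp
    have neq: "H (insert s A) \<noteq> H S"
      using cube_subset_imp_dims_subset[of a F b' E'] S(2) 1(5) F E'F
      by (metis 1(2) S(2) base_in_cube cube_rebase cube_subset_imp_dims_subset order_refl psubsetE)
    have "insert s A \<subseteq> S" "E' \<subseteq> {1..n}"
      using 1 A F by auto
    then obtain t c E'' where 2: "t \<in> S" "c \<in> V" "E' \<subset> E''" "E'' \<subseteq> F"
        "E'' = F \<longrightarrow> H (insert t (insert s A)) = H S"
      using step[OF _ 1(5) 1(2) _ neq] card' by auto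
    have "card E' < card E''"
      using 2(3,4) finF finite_subset psubset_card_mono by metis
    then have "card E'' = card F"
      using card' card_mono[OF finF 2(4)] by linarith
    then have "E'' = F"
      using card_subset_eq[OF finF 2(4)] by blast
    then show ?thesis
      using 2 1 E'F \<open>insert s A \<subseteq> S\<close> by blast
  qed
qed

text \<open>
  Two vertices at distance 2 suffice. They exist: if \<open>x\<close> and \<open>y\<close> differ only in \<open>i\<close>, a vertex \<open>z\<close>
  outside the line through them differs from both in the second coordinate, and from at least one of
  them in \<open>i\<close>.
\<close>
lemma small_spanning_subset_2dim:
  assumes S: "S \<subseteq> V" "H S = cube a F" and a: "a \<in> V" and F: "F \<subseteq> {1..n}" "card F = 2"
  shows "\<exists>R\<subseteq>S. H R = H S \<and> card R \<le> 2"
proof -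
  have finF: "finite F"
    using F finite_subset by blast
  have SF: "H S = cube x F" "x \<in> V" if "x \<in> S" for x
    using that S hull_smallest(2)[of S] cube_rebase by auto
  have dF: "diff x y \<subseteq> F" if "x \<in> S" "y \<in> S" for x y
    using SF[OF that(1)] hull_smallest(2)[OF S(1)] that(2) by (auto simp: cube_def)
  have pair: "H {x, y} = cube x (diff x y)" if "x \<in> S" "y \<in> S" for x y
  proof -
    have "card (diff x y) \<le> 2"
      using card_mono[OF finF dF[OF that]] F by simp
    then show ?thesis
      using hull_join[of "{x}" x "{}" "{y}" y "{}"] hull_singleton SF that by (simp add: insert_commute)
  qed
  have "\<exists>x\<in>S. \<exists>y\<in>S. diff x y = F"
  proof (rule ccontr)
    assume no: "\<not> ?thesis"
    have "S \<noteq> {}"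
      using S(2) hull_empty base_in_cube[OF a] by auto
    then obtain x where x: "x \<in> S" by blast
    have dimle: "F \<subseteq> E" if "S \<subseteq> cube x E" for E
      using hull_smallest(3)[OF S(1) cube_convex that] SF[OF x] F
        cube_subset_imp_dims_subset by blast
    obtain y where y: "y \<in> S" "diff x y \<noteq> {}"
      using dimle[of "{}"] F S(1) by (fastforce simp: cube_def)
    have "card (diff x y) < 2"
      using psubset_card_mono[OF finF, of "diff x y"] no dF[OF x y(1)] x y F by auto
    then have "card (diff x y) = 1"
      using y(2) by (simp add: less_2_cases_iff)
    then obtain i where i: "diff x y = {i}"
      by (auto simp: card_1_singleton_iff)
    have "\<not> F \<subseteq> {i}"
      using card_mono[of "{i}" F] F by auto
    then have "\<not> S \<subseteq> cube x {i}"
      using dimle by blast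
    then obtain z where z: "z \<in> S" "\<not> diff x z \<subseteq> {i}"
      using S(1) by (auto simp: cube_def)
    then obtain j where j: "j \<in> diff x z" "j \<noteq> i" by blast
    have ij: "{i, j} = F"
      using dF[OF x z(1)] dF[OF x y(1)] i j finF F by (intro card_subset_eq) auto
    have in_diff: "k \<in> diff u w \<longleftrightarrow> k \<in> {1..n} \<and> u k \<noteq> w k" for k u w
      by (simp add: diff_def)
    have "i \<in> diff x y" "j \<notin> diff x y"
      using i j by auto
    then have "j \<in> diff y z" "i \<in> diff x z \<or> i \<in> diff y z"
      using j(1) unfolding in_diff by metis+
    then have "diff x z = F \<or> diff y z = F"
      using dF[OF x z(1)] dF[OF y(1) z(1)] ij j by auto
    then show False
      using no x y z by blast
  qed
  then obtain x y where "x \<in> S" "y \<in> S" "diff x y = F" by blast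
  then show ?thesis
    using pair SF by (intro exI[of _ "{x, y}"]) (auto simp: card_insert_if)
qed

text \<open>
  The existential form, in contrast to a bound on the size of minimal spanning sets, makes the
  induction hypothesis applicable to parts that are not themselves minimal.
\<close>
theorem small_spanning_subset:
  assumes "S \<subseteq> V" "H S = cube a F" "a \<in> V" "F \<subseteq> {1..n}"
  shows "\<exists>R\<subseteq>S. H R = H S \<and> card R \<le> bound (card F)"
  using assms
proof (induction "card F" arbitrary: S a F rule: less_induct)
  case less
  note S = less.prems
  have finS: "finite S"
    using S(1) finite_V finite_subset by blast
  have finF: "finite F"
    using S(4) finite_subset by blast
  let ?P = "{R. R \<subseteq> S \<and> H R = H S}"
  have "finite ?P"
    by (rule finite_subset[of _ "Pow S"]) (use finS in auto)
  then obtain R where R: "R \<subseteq> S" "H R = H S" and minR: "\<forall>T\<in>?P. T \<subseteq> R \<longrightarrow> R = T"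
    using finite_has_minimal[of ?P] by blast
  have min: "H T \<noteq> H S" if "T \<subset> R" for T
    using minR R(1) that by blast
  have RV: "R \<subseteq> V" and HR: "H R = cube a F"
    using R S by auto
  have IH: "\<exists>T\<subseteq>A. H T = H A \<and> card T \<le> bound (card E)"
    if "A \<subseteq> R" "H A = cube b E" "b \<in> V" "E \<subset> F" for A b E
    using less.hyps[of E A b] psubset_card_mono[OF finF that(4)] that RV S(4) by auto
  \<comment> \<open>By minimality of \<open>R\<close>, no proper subset of it spans the large cube.\<close>
  have smaller: "\<exists>b\<in>V. \<exists>E. E \<subset> F \<and> H A = cube b E" if A: "A \<subset> R" "spans_cube A" for A
  proof -
    obtain b E where b: "b \<in> V" "E \<subseteq> {1..n}" "H A = cube b E"
      using A(2) unfolding spans_cube_def by blast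
    have sub: "cube b E \<subseteq> cube a F"
      using hull_mono[of A R] A(1) RV b HR by auto
    then have "E \<subseteq> F"
      using cube_subset_imp_dims_subset b by blast
    moreover have "E \<noteq> F"
      using min[OF A(1)] b(3) R HR sub base_in_cube[OF b(1)] cube_rebase by blast
    ultimately show ?thesis
      using b by blast
  qed
  consider "card R \<le> 1" | "card F = 2" | "2 \<le> card R" "card F \<noteq> 2" by linarith
  then show ?case
  proof cases
    case 1
    then show ?thesis
      using R bound_ge_1[of "card F"] by (intro exI[of _ R]) auto
  next
    case 2
    then show ?thesis
      using small_spanning_subset_2dim[OF S] by (simp add: numeral_2_eq_2)
  next
    case 3
    have "spans_cube R"
      using RV HR S(3,4) unfolding spans_cube_def by blast
    then obtain A B where AB: "A \<subset> R" "B \<subset> R" "A \<union> B = R" "spans_cube A" "spans_cube B"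
      using spanning_set_split[OF _ 3(1)] by metis
    obtain x D where D: "x \<in> V" "D \<subset> F" "H A = cube x D"
      using smaller[OF AB(1,4)] by blast
    obtain y E where E: "y \<in> V" "E \<subset> F" "H B = cube y E"
      using smaller[OF AB(2,5)] by blast
    show ?thesis
    proof (cases "card F \<le> card D + 2 \<or> card F \<le> card E + 2")
      case True
      then obtain C c K where C: "C \<subset> R" "c \<in> V" "K \<subset> F" "H C = cube c K" "card F \<le> card K + 2"
      proof
        assume "card F \<le> card D + 2"
        then show ?thesis
          using that[OF AB(1) D] by blast
      next
        assume "card F \<le> card E + 2"
        then show ?thesis
          using that[OF AB(2) E] by blast
      qed
      have "H C \<noteq> H R" "K \<subseteq> {1..n}" "C \<subseteq> R"
        using min[OF C(1)] R(2) C(1,3) S(4) by auto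
      then obtain s A' b' E' where s: "s \<in> R" "A' \<subseteq> R" "b' \<in> V" "E' \<subset> F" "H A' = cube b' E'"
          "H (insert s A') = H R"
        using spanning_set_last_step[OF RV HR S(4) _ C(4,2) _ _ C(5)] by blast
      \<comment> \<open>Replacing \<open>A'\<close> by a small set with the same hull leaves only \<open>s\<close> to be added.\<close>
      obtain T where T: "T \<subseteq> A'" "H T = H A'" "card T \<le> bound (card E')"
        using IH[OF s(2,5,3,4)] by blast
      have "H (T \<union> {s}) = H (A' \<union> {s})"
        using T s RV by (intro hull_Un_cong) auto
      then have "H (insert s T) = H S"
        using s(6) R(2) by simp
      moreover have "card (insert s T) \<le> bound (card F)"
      proof -
        have lt: "card E' < card F"
          using psubset_card_mono[OF finF s(4)] .
        have "card (insert s T) \<le> card T + 1"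
          by (simp add: card_insert_le_m1 card_insert_if finite_subset)
        also have "\<dots> \<le> bound (card F - 1) + 1"
          using T(3) bound_mono[of "card E'" "card F - 1"] lt by linarith
        also have "\<dots> \<le> bound (card F)"
          using bound_Suc[of "card F - 1"] lt 3(2) by simp
        finally show ?thesis .
      qed
      moreover have "insert s T \<subseteq> S"
        using s T R by blast
      ultimately show ?thesis by blast
    next
      case False
      obtain T U where T: "T \<subseteq> A" "H T = H A" "card T \<le> bound (card D)"
        and U: "U \<subseteq> B" "H U = H B" "card U \<le> bound (card E)"
        using IH[OF _ D(3,1,2)] IH[OF _ E(3,1,2)] AB(1,2) by (metis psubset_imp_subset)
      have "H (T \<union> U) = H (A \<union> B)"
        using T U AB RV by (intro hull_Un_cong) auto
      then have "H (T \<union> U) = H S"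
        using AB R by simp
      moreover have "card (T \<union> U) \<le> bound (card F)"
      proof -
        have "card (T \<union> U) \<le> card T + card U"
          by (rule card_Un_le)
        also have "\<dots> \<le> 2 * bound (card F - 3)"
          using T(3) U(3) bound_mono[of "card D" "card F - 3"] bound_mono[of "card E" "card F - 3"]
            False by linarith
        also have "\<dots> \<le> bound (card F)"
          using bound_add3[of "card F - 3"] False by simp
        finally show ?thesis .
      qed
      moreover have "T \<union> U \<subseteq> S"
        using T U AB R by blast
      ultimately show ?thesis by blast
    qed
  qed
qed

theorem max_minimal_hull_le_bound: "max_minimal_hull (hamming_graph n r) \<le> bound n"
proof -
  have "card S \<le> bound n" if "minimal_hull_set (hamming_graph n r) S" for S
  proof -
    have S: "S \<subseteq> V" "H S = V" and min: "\<forall>R. R \<subset> S \<longrightarrow> H R \<subset> V"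
      using that unfolding minimal_hull_set_def by simp_all
    have "(\<lambda>i\<in>{1..n}. 0) \<in> V"
      unfolding pverts_hamming_graph by (rule restrict_PiE_iff[THEN iffD2]) (use two_values in force)
    then obtain a where a: "a \<in> V" by blast
    have "cube a {1..n} = V"
      using diff_subset by (auto simp: cube_def)
    then obtain R where "R \<subseteq> S" "H R = V" "card R \<le> bound n"
      using small_spanning_subset[of S a "{1..n}"] S a by auto
    moreover from this have "R = S"
      using min by blast
    ultimately show ?thesis by simp
  qed
  then show ?thesis
    using finite_minimal_hull_sets[OF pair_graph_hamming_graph, of n r]
      ex_minimal_hull_set[OF pair_graph_hamming_graph, of n r]
    unfolding max_minimal_hull_def by (subst Max_le_iff) auto
qed

end

theorem lemma3p2:
  fixes n :: nat and r :: "nat \<Rightarrow> nat"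
  assumes "n \<ge> 7" and "\<forall>i\<in>{1..n}. r i \<ge> 2"
  shows "(n mod 3 = 0 \<longrightarrow> max_minimal_hull (hamming_graph n r) \<le> 3 * 2 ^ (n div 3 - 1)) \<and>
    (n mod 3 = 1 \<longrightarrow> max_minimal_hull (hamming_graph n r) \<le> 4 * 2 ^ ((n - 1) div 3 - 1)) \<and>
    (n mod 3 = 2 \<longrightarrow> max_minimal_hull (hamming_graph n r) \<le> 5 * 2 ^ ((n - 2) div 3 - 1))"
proof -
  interpret hamming n r
    using assms(2) by unfold_locales auto
  define k where "k = n div 3"
  have k: "1 \<le> k"
    using assms(1) unfolding k_def by linarith
  have "n mod 3 = j \<Longrightarrow> n = 3 * k + j" for j
    using mult_div_mod_eq[of 3 n] unfolding k_def by linarith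
  then have "n mod 3 = 0 \<longrightarrow> n = 3 * k" "n mod 3 = 1 \<longrightarrow> n = 3 * k + 1" "n mod 3 = 2 \<longrightarrow> n = 3 * k + 2"
    by auto
  then show ?thesis
    using max_minimal_hull_le_bound bound_eq[OF k] by auto
qed

end
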